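(* Let $V$ be a finite set with a total order $\prec$ and let $\mathcal{K}$ be a simplicial complex with its vertices in $V$. Let $t,s\geq 0$ be integers and let $m\in \mathbb{Z}$. Suppose $m=\lambda(2t+1)+q$ where $\lambda\in \mathbb{Z}$ and $0\leq q\leq 2t$. Then for any $\alpha\in \mathrm{Ext}_{2t+1}(V)$ and $\beta\in \mathrm{Ext}_{2s}(V)$, there is a homomorphism $$\beta_*:\ H_n(\mathcal{K},\alpha,m)\longrightarrow H_n(\mathcal{K},\alpha,m-2s),\qquad n\geq 0,$$ of the constrained homology groups, induced by $\beta$ (i.e. sending the class of a cycle $x$ to the class of $\beta(x)$).
   Context: For $n\ge 0$, $\Lambda_n(V)$ is the real vector space with basis the elementary $n$-paths on $V$, i.e. all ordered sequences $v_0v_1\ldots v_n$ of $n+1$ vertices of $V$ (repetitions allowed, no order condition); $\Lambda_k(V)=0$ for $k<0$. Let $\delta(u,v)=1$ if $u=v$ and $0$ otherwise. For $v\in V$, the linear map $\frac{\partial}{\partial v}:\Lambda_n(V)\to\Lambda_{n-1}(V)$ ($n\ge0$) is given by $$\frac{\partial}{\partial v}(v_0v_1\ldots v_n)=\sum_{i=0}^n(-1)^i\delta(v,v_i)\,v_0\ldots\widehat{v_i}\ldots v_n.$$ One has $\frac{\partial}{\partial u}\circ\frac{\partial}{\partial v}=-\frac{\partial}{\partial v}\circ\frac{\partial}{\partial u}$. $\mathrm{Ext}_*(V)=\bigoplus_{k\ge0}\mathrm{Ext}_k(V)$ is the real exterior algebra generated by the $\frac{\partial}{\partial v}$, $v\in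 V$ ($\mathrm{Ext}_0(V)=\mathbb{R}$ acts by scalars), with product $\wedge$ the composition of linear maps, so an element of $\mathrm{Ext}_k(V)$ acts as linear maps $\Lambda_n(V)\to\Lambda_{n-k}(V)$. An $n$-hyperedge on $V$ is a sequence $v_0v_1\ldots v_n$ of vertices with $v_0\prec v_1\prec\cdots\prec v_n$, identified with the set $\{v_0,\ldots,v_n\}$. A simplicial complex $\mathcal{K}$ with vertices in $V$ is a set of hyperedges on $V$ such that every non-empty subset of an element of $\mathcal{K}$ is in $\mathcal{K}$; the $n$-hyperedges in $\mathcal{K}$ are its $n$-simplices. $C_n(\mathcal{K};\mathbb{R})\subseteq\Lambda_n(V)$ is the real vector space of linear combinations of $n$-simplices of $\mathcal{K}$; it is $0$ for $n<0$. Elements of $\mathrm{Ext}_*(V)$ act on $C_*(\mathcal{K};\mathbb{R})$ by restriction. Given $t\ge0$, each integer $m$ is written uniquely as $m=\lambda(2t+1)+q$ with $\lambda\in\mathbb{Z}$, $0\le q\le 2t$. For $\alpha\in\mathrm{Ext}_{2t+1}(V)$, $C_*(\mathcal{K},\alpha,m)$ is the chain complex with degree-$n$ term $C_{(n+\lambda)(2t+1)+q}(\mathcal{K};\mathbb{R})$, $n\ge0$, and boundary map $\alpha$ (zero out of degree $n=0$). The $n$-th constrained homology group of $\mathcal{K}$ with respect to $\alpha$ and $m$ is $H_n(\mathcal{K},\alpha,m)=H_n(C_*(\mathcal{K},\alpha,m))$, i.e. the kernel of $\alpha$ on the degree-$n$ term modulo the image of $\alpha$ from the degree-$(n+1)$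 term. *)

theory Defs
  imports Complex_Main "HOL-Library.Poly_Mapping" "HOL-Algebra.Coset"
begin

instantiation poly_mapping :: (type, real_vector) real_vector
begin

lift_definition scaleR_poly_mapping :: "real \<Rightarrow> ('a \<Rightarrow>\<^sub>0 'b) \<Rightarrow> 'a \<Rightarrow>\<^sub>0 'b"
  is "\<lambda>c f k. c *\<^sub>R f k"
  by (rule finite_subset) auto

instance
  by standard (transfer; auto simp: scaleR_add_left scaleR_add_right)+

end

text \<open>
  The space of all paths is the free real vector space on the lists of vertices. The elementary
  \<open>n\<close>-path \<open>v\<^sub>0 v\<^sub>1 \<dots> v\<^sub>n\<close> is the basis vector of the list \<open>[v\<^sub>0, \<dots>, v\<^sub>n]\<close> of length \<open>n + 1\<close>, and
  \<open>\<Lambda>\<^sub>n(V)\<close> is the subspace spanned by the lists of length \<open>n + 1\<close> over \<open>V\<close>. The empty list does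
  not belong to any \<open>\<Lambda>\<^sub>n(V)\<close>, since \<open>\<Lambda>\<^sub>-\<^sub>1(V) = 0\<close>.
\<close>

type_synonym 'v chain = "'v list \<Rightarrow>\<^sub>0 real"

definition linear_extend :: "('v list \<Rightarrow> 'v chain) \<Rightarrow> 'v chain \<Rightarrow> 'v chain" where
  "linear_extend b x = (\<Sum>p\<in>Poly_Mapping.keys x. Poly_Mapping.lookup x p *\<^sub>R b p)"

text \<open>
  The case distinction implements \<open>\<Lambda>\<^sub>-\<^sub>1(V) = 0\<close>: a \<open>0\<close>-path is not sent to the empty list but
  to \<open>0\<close>.
\<close>

definition path_deriv :: "'v \<Rightarrow> 'v list \<Rightarrow> 'v chain" where
  "path_deriv v p =
     (if length p \<le> 1 then 0
      else \<Sum>i<length p. ((-1) ^ i * (if v = p ! i then 1 else 0)) *\<^sub>R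
             Poly_Mapping.single (take i p @ drop (Suc i) p) 1)"

definition partial_deriv :: "'v \<Rightarrow> 'v chain \<Rightarrow> 'v chain" where
  "partial_deriv v = linear_extend (path_deriv v)"

definition deriv_word :: "'v list \<Rightarrow> 'v chain \<Rightarrow> 'v chain" where
  "deriv_word vs = foldr (\<lambda>v f. partial_deriv v \<circ> f) vs id"

text \<open>
  The wedge product is the composition of linear maps, so the degree-\<open>k\<close> part of the exterior
  algebra consists of the real linear combinations of the operators
  \<open>\<partial>/\<partial>v\<^sub>1 \<circ> \<dots> \<circ> \<partial>/\<partial>v\<^sub>k\<close>. For finite \<open>V\<close> there are finitely many words of length \<open>k\<close>; a basis is
  obtained from the strictly increasing ones.
\<close>

definition Ext :: "'v set \<Rightarrow> nat \<Rightarrow> ('v chain \<Rightarrow> 'v chain) set" where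
  "Ext V k = {\<alpha>. \<exists>c :: 'v list \<Rightarrow> real.
     \<alpha> = (\<lambda>x. \<Sum>vs | set vs \<subseteq> V \<and> length vs = k. c vs *\<^sub>R deriv_word vs x)}"

definition hyperedges :: "'v::linorder set \<Rightarrow> 'v list set" where
  "hyperedges V = {\<sigma>. \<sigma> \<noteq> [] \<and> set \<sigma> \<subseteq> V \<and> sorted_wrt (<) \<sigma>}"

definition simplicial_complex :: "'v::linorder set \<Rightarrow> 'v list set \<Rightarrow> bool" where
  "simplicial_complex V K \<longleftrightarrow>
     K \<subseteq> hyperedges V \<and> (\<forall>\<sigma>\<in>K. \<forall>\<tau>\<in>hyperedges V. set \<tau> \<subseteq> set \<sigma> \<longrightarrow> \<tau> \<in> K)"

text \<open>
  Degrees are integers. An \<open>n\<close>-simplex is a list of length \<open>n + 1\<close>; as a complex does not contain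
  the empty list, this is \<open>0\<close> for \<open>n < 0\<close>.
\<close>

definition simplicial_chains :: "'v list set \<Rightarrow> int \<Rightarrow> 'v chain set" where
  "simplicial_chains K n =
     {x. \<forall>\<sigma>\<in>Poly_Mapping.keys x. \<sigma> \<in> K \<and> int (length \<sigma>) = n + 1}"

text \<open>
  The unique \<open>\<lambda>\<close>, \<open>q\<close> with \<open>m = \<lambda> (2 t + 1) + q\<close> and \<open>0 \<le> q \<le> 2 t\<close> are the integer quotient and
  remainder of \<open>m\<close> by \<open>2 t + 1\<close>.
\<close>

definition constrained_chains :: "'v list set \<Rightarrow> nat \<Rightarrow> int \<Rightarrow> nat \<Rightarrow> 'v chain set" where
  "constrained_chains K t m n =
     (let d = 2 * int t + 1; l = m div d; q = m mod d
      in simplicial_chains K ((int n + l) * d + q))"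

definition constrained_boundary :: "('v chain \<Rightarrow> 'v chain) \<Rightarrow> nat \<Rightarrow> 'v chain \<Rightarrow> 'v chain" where
  "constrained_boundary \<alpha> n x = (if n = 0 then 0 else \<alpha> x)"

definition constrained_cycles ::
    "'v list set \<Rightarrow> nat \<Rightarrow> ('v chain \<Rightarrow> 'v chain) \<Rightarrow> int \<Rightarrow> nat \<Rightarrow> 'v chain set" where
  "constrained_cycles K t \<alpha> m n =
     {x \<in> constrained_chains K t m n. constrained_boundary \<alpha> n x = 0}"

definition constrained_boundaries ::
    "'v list set \<Rightarrow> nat \<Rightarrow> ('v chain \<Rightarrow> 'v chain) \<Rightarrow> int \<Rightarrow> nat \<Rightarrow> 'v chain set" where
  "constrained_boundaries K t \<alpha> m n =
     constrained_boundary \<alpha> (Suc n) ` constrained_chains K t m (Suc n)"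

definition cycle_group ::
    "'v list set \<Rightarrow> nat \<Rightarrow> ('v chain \<Rightarrow> 'v chain) \<Rightarrow> int \<Rightarrow> nat \<Rightarrow> 'v chain monoid" where
  "cycle_group K t \<alpha> m n =
     \<lparr>carrier = constrained_cycles K t \<alpha> m n, monoid.mult = (+), one = 0\<rparr>"

definition constrained_homology ::
    "'v list set \<Rightarrow> nat \<Rightarrow> ('v chain \<Rightarrow> 'v chain) \<Rightarrow> int \<Rightarrow> nat \<Rightarrow> 'v chain set monoid" where
  "constrained_homology K t \<alpha> m n =
     cycle_group K t \<alpha> m n Mod constrained_boundaries K t \<alpha> m n"

definition homology_class ::
    "'v list set \<Rightarrow> nat \<Rightarrow> ('v chain \<Rightarrow> 'v chain) \<Rightarrow> int \<Rightarrow> nat \<Rightarrow> 'v chain \<Rightarrow> 'v chain set" where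
  "homology_class K t \<alpha> m n x =
     constrained_boundaries K t \<alpha> m n #>\<^bsub>cycle_group K t \<alpha> m n\<^esub> x"

text \<open>
  Scalar multiplication of the quotient vector space. The library quotient only carries the
  additive structure. All members of the union coincide when \<open>X\<close> is a homology class.
\<close>

definition homology_scale ::
    "'v list set \<Rightarrow> nat \<Rightarrow> ('v chain \<Rightarrow> 'v chain) \<Rightarrow> int \<Rightarrow> nat \<Rightarrow>
     real \<Rightarrow> 'v chain set \<Rightarrow> 'v chain set" where
  "homology_scale K t \<alpha> m n c X = (\<Union>x\<in>X. homology_class K t \<alpha> m n (c *\<^sub>R x))"

end

theory Submission
  imports Defs
begin

text \<open>
  Partial derivatives anticommute, so elements of degrees \<open>k\<close> and \<open>l\<close> of the exterior algebra
  commute up to the sign \<open>(-1)\<^sup>k\<^sup>l\<close>. Hence an odd \<open>\<alpha>\<close> squares to zero and commutes with an even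
  \<open>\<beta>\<close>, so \<open>\<beta>\<close> is a chain map lowering \<open>m\<close> by its degree and descends to homology.
  The anticommutation is proved by induction on paths after dropping the convention
  \<open>\<Lambda>\<^sub>-\<^sub>1(V) = 0\<close>: the derivatives that may produce the empty path are antiderivations with
  respect to prepending a vertex.
\<close>

section \<open>Linear maps on the free vector space of lists\<close>

lemma lookup_scaleR [simp]:
  "Poly_Mapping.lookup (c *\<^sub>R x) k = c *\<^sub>R Poly_Mapping.lookup x k"
  by transfer simp

text \<open>Cancellation or a zero scalar can make the keys of a combination smaller than expected;
  a common finite index set lets the sums be compared termwise.\<close>

lemma linear_extend_superset:
  assumes "finite A" "Poly_Mapping.keys x \<subseteq> A"
  shows "linear_extend b x = (\<Sum>p\<in>A. Poly_Mapping.lookup x p *\<^sub>R b p)"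
  unfolding linear_extend_def using assms
  by (intro sum.mono_neutral_left) (auto simp: in_keys_iff)

lemma linear_linear_extend: "linear (linear_extend b)"
proof (rule linearI)
  fix x y :: "'a chain" and c :: real
  let ?A = "Poly_Mapping.keys x \<union> Poly_Mapping.keys y"
  have "linear_extend b (x + y) = (\<Sum>p\<in>?A. Poly_Mapping.lookup (x + y) p *\<^sub>R b p)"
    by (rule linear_extend_superset) (simp_all add: Poly_Mapping.keys_add)
  also have "\<dots> = (\<Sum>p\<in>?A. Poly_Mapping.lookup x p *\<^sub>R b p)
                  + (\<Sum>p\<in>?A. Poly_Mapping.lookup y p *\<^sub>R b p)"
    by (simp add: lookup_add scaleR_add_left sum.distrib)
  also have "\<dots> = linear_extend b x + linear_extend b y"
    by (simp add: linear_extend_superset[of ?A x b] linear_extend_superset[of ?A y b])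
  finally show "linear_extend b (x + y) = linear_extend b x + linear_extend b y" .
  have "linear_extend b (c *\<^sub>R x)
      = (\<Sum>p\<in>Poly_Mapping.keys x. Poly_Mapping.lookup (c *\<^sub>R x) p *\<^sub>R b p)"
    by (rule linear_extend_superset) (auto simp: in_keys_iff)
  then show "linear_extend b (c *\<^sub>R x) = c *\<^sub>R linear_extend b x"
    by (simp add: linear_extend_def scaleR_sum_right)
qed

lemma linear_extend_single [simp]: "linear_extend b (Poly_Mapping.single p 1) = b p"
  by (simp add: linear_extend_def)

lemma chain_expand:
  fixes x :: "'v chain"
  shows "x = (\<Sum>p\<in>Poly_Mapping.keys x. Poly_Mapping.lookup x p *\<^sub>R Poly_Mapping.single p 1)"
  by (rule poly_mapping_eqI)
    (auto simp: lookup_sum lookup_single when_def in_keys_iff if_distrib[of "(*) _"]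
      cong: if_cong)

text \<open>The single paths span all chains, so every operator identity below only has to be
  checked on one path at a time.\<close>

lemma linear_chain_eqI:
  fixes f g :: "'v chain \<Rightarrow> 'w::real_vector"
  assumes "linear f" "linear g"
    and "\<And>p. f (Poly_Mapping.single p 1) = g (Poly_Mapping.single p 1)"
  shows "f x = g x"
  by (subst (1 2) chain_expand) (simp add: linear_sum[OF assms(1)] linear_sum[OF assms(2)]
      linear_scale[OF assms(1)] linear_scale[OF assms(2)] assms(3))

section \<open>Anticommutation of the partial derivatives\<close>

text \<open>The augmented version of \<open>path_deriv\<close>: a \<open>0\<close>-path may be sent
  to the empty path, which makes the recursion along a list uniform.\<close>

definition face_sum :: "'v \<Rightarrow> 'v list \<Rightarrow> 'v chain" where
  "face_sum v p = (\<Sum>i<length p. ((-1) ^ i * (if v = p ! i then 1 else 0)) *\<^sub>R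
     Poly_Mapping.single (take i p @ drop (Suc i) p) 1)"

definition cons_chain :: "'v \<Rightarrow> 'v chain \<Rightarrow> 'v chain" where
  "cons_chain a = linear_extend (\<lambda>p. Poly_Mapping.single (a # p) 1)"

text \<open>The projection that discards the empty path; it passes from the augmented setting back
  to the convention that nothing lives in degree \<open>-1\<close>.\<close>

definition kill_empty :: "'v chain \<Rightarrow> 'v chain" where
  "kill_empty = linear_extend (\<lambda>p. if p = [] then 0 else Poly_Mapping.single p 1)"

abbreviation "full_deriv v \<equiv> linear_extend (face_sum v)"

lemma face_sum_Nil [simp]: "face_sum v [] = 0"
  by (simp add: face_sum_def)

lemma linear_cons_chain: "linear (cons_chain a)"
  and linear_kill_empty: "linear kill_empty"
  and linear_partial_deriv: "linear (partial_deriv v)"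
  by (simp_all add: cons_chain_def kill_empty_def partial_deriv_def linear_linear_extend)

text \<open>The summand \<open>i = 0\<close> deletes \<open>a\<close>; in all others
  \<open>a\<close> survives and the index shift contributes the minus sign.\<close>

lemma face_sum_Cons:
  "face_sum v (a # p)
     = (if v = a then 1 else 0) *\<^sub>R Poly_Mapping.single p 1 - cons_chain a (face_sum v p)"
  unfolding face_sum_def length_Cons sum.lessThan_Suc_shift
  by (simp del: sum.lessThan_Suc add: linear_sum[OF linear_cons_chain]
      linear_scale[OF linear_cons_chain])
    (simp add: cons_chain_def sum_negf)

lemma full_deriv_cons_chain:
  "full_deriv v (cons_chain a x) = (if v = a then 1 else 0) *\<^sub>R x - cons_chain a (full_deriv v x)"
proof (rule linear_chain_eqI[where f = "\<lambda>x. full_deriv v (cons_chain a x)"])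
  show "linear (\<lambda>x. full_deriv v (cons_chain a x))"
    using linear_compose[OF linear_cons_chain linear_linear_extend] by (simp add: o_def)
  show "linear (\<lambda>x. (if v = a then 1 else 0) *\<^sub>R x - cons_chain a (full_deriv v x))"
    using linear_compose[OF linear_linear_extend linear_cons_chain]
    by (intro linear_compose_sub linear_compose_scale_right linear_ident) (simp add: o_def)
qed (simp add: face_sum_Cons cons_chain_def)

text \<open>For \<open>a # p\<close> the antiderivation rule gives two terms in which one derivative
  removes \<open>a\<close>, with opposite signs and exchanged by swapping \<open>u\<close> and
  \<open>v\<close>, plus \<open>a\<close> prepended to the iterated derivative of \<open>p\<close>,
  where the induction hypothesis applies.\<close>

lemma full_deriv_face_sum: "full_deriv u (face_sum v p) = - full_deriv v (face_sum u p)"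
proof (induction p)
  case (Cons a p)
  then show ?case
    by (simp add: face_sum_Cons linear_diff[OF linear_linear_extend]
        linear_0[OF linear_linear_extend] full_deriv_cons_chain
        linear_neg[OF linear_cons_chain])
qed (simp add: linear_0[OF linear_linear_extend])

lemma path_deriv_eq: "path_deriv v p = kill_empty (face_sum v p)"
proof (cases "length p \<le> 1")
  case True
  then consider "p = []" | a where "p = [a]" by (cases p) auto
  then show ?thesis
    by cases (auto simp: path_deriv_def face_sum_def kill_empty_def linear_0[OF linear_linear_extend])
next
  case False
  \<comment> \<open>For \<open>i = 0\<close> the tail is left, for \<open>i > 0\<close> the first
    vertex is; so \<open>kill_empty\<close> fixes every face.\<close>
  then have "take i p @ drop (Suc i) p \<noteq> []" for i
    by (cases i) auto
  then show ?thesis using False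
    by (simp add: path_deriv_def face_sum_def linear_sum[OF linear_kill_empty]
        linear_scale[OF linear_kill_empty]) (auto simp: kill_empty_def intro!: sum.cong)
qed

lemma partial_deriv_eq: "partial_deriv v x = kill_empty (full_deriv v x)"
proof (rule linear_chain_eqI[OF linear_partial_deriv])
  show "linear (\<lambda>x. kill_empty (full_deriv v x))"
    using linear_compose[OF linear_linear_extend linear_kill_empty] by (simp add: o_def)
qed (simp add: partial_deriv_def path_deriv_eq)

text \<open>The empty path has derivative zero, so discarding it beforehand changes nothing. Inner
  projections in a composite of derivatives can therefore be dropped.\<close>

lemma full_deriv_kill_empty: "full_deriv v (kill_empty x) = full_deriv v x"
proof (rule linear_chain_eqI[where f = "\<lambda>x. full_deriv v (kill_empty x)"])
  show "linear (\<lambda>x. full_deriv v (kill_empty x))"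
    using linear_compose[OF linear_kill_empty linear_linear_extend] by (simp add: o_def)
qed (simp_all add: linear_linear_extend kill_empty_def linear_0[OF linear_linear_extend])

lemma partial_deriv_anticommute:
  "partial_deriv u (partial_deriv v x) = - partial_deriv v (partial_deriv u x)"
proof -
  have "full_deriv u (full_deriv v x) = - full_deriv v (full_deriv u x)"
  proof (rule linear_chain_eqI[where f = "\<lambda>x. full_deriv u (full_deriv v x)"])
    have *: "linear (\<lambda>x. full_deriv u (full_deriv v x))" for u v :: 'a
      using linear_compose[OF linear_linear_extend linear_linear_extend] by (simp add: o_def)
    show "linear (\<lambda>x. full_deriv u (full_deriv v x))" by (rule *)
    show "linear (\<lambda>x. - full_deriv v (full_deriv u x))"
      by (intro linear_compose_neg *)
  qed (simp add: full_deriv_face_sum[of u v])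
  then show ?thesis
    by (simp add: partial_deriv_eq full_deriv_kill_empty linear_neg[OF linear_kill_empty])
qed

section \<open>Graded commutativity of the exterior algebra\<close>

lemma deriv_word_simps [simp]:
  "deriv_word [] x = x"
  "deriv_word (v # vs) x = partial_deriv v (deriv_word vs x)"
  by (simp_all add: deriv_word_def)

lemma linear_deriv_word: "linear (deriv_word vs)"
proof (induction vs)
  case (Cons v vs)
  then show ?case
    using linear_compose[OF Cons linear_partial_deriv] by (simp add: o_def deriv_word_def)
qed (simp add: deriv_word_def id_def linear_ident)

text \<open>Moving the derivative past each letter of the word costs one sign.\<close>

lemma partial_deriv_word_commute:
  "partial_deriv v (deriv_word ws x) = (-1) ^ length ws *\<^sub>R deriv_word ws (partial_deriv v x)"
proof (induction ws)
  case (Cons w ws)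
  then show ?case
    by (simp add: partial_deriv_anticommute[of v w] linear_scale[OF linear_partial_deriv])
qed simp

lemma deriv_word_commute:
  "deriv_word vs (deriv_word ws x)
     = (-1) ^ (length vs * length ws) *\<^sub>R deriv_word ws (deriv_word vs x)"
proof (induction vs)
  case (Cons v vs)
  then show ?case
    by (simp add: partial_deriv_word_commute linear_scale[OF linear_partial_deriv] power_add
        mult.commute)
qed simp

lemma linear_Ext:
  assumes "\<alpha> \<in> Ext V k"
  shows "linear \<alpha>"
  using assms linear_deriv_word unfolding Ext_def
  by (auto intro!: linear_compose_sum linear_compose_scale_right)

text \<open>Both composites expand bilinearly into words, and all pairs of words of lengths
  \<open>k\<close> and \<open>l\<close> commute up to the same sign, which can be pulled
  out.\<close>

lemma Ext_commute:
  assumes "\<alpha> \<in> Ext V k" "\<beta> \<in> Ext V l"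
  shows "\<alpha> (\<beta> x) = (-1) ^ (k * l) *\<^sub>R \<beta> (\<alpha> x)"
proof -
  let ?W = "\<lambda>k. {vs. set vs \<subseteq> V \<and> length vs = k}"
  obtain a b where a: "\<And>x. \<alpha> x = (\<Sum>vs\<in>?W k. a vs *\<^sub>R deriv_word vs x)"
    and b: "\<And>x. \<beta> x = (\<Sum>ws\<in>?W l. b ws *\<^sub>R deriv_word ws x)"
    using assms unfolding Ext_def by auto
  have "\<alpha> (\<beta> x) = (\<Sum>vs\<in>?W k. \<Sum>ws\<in>?W l. (a vs * b ws) *\<^sub>R deriv_word vs (deriv_word ws x))"
    by (simp add: a b linear_sum[OF linear_deriv_word] linear_scale[OF linear_deriv_word]
        scaleR_sum_right)
  also have "\<dots> = (\<Sum>vs\<in>?W k. \<Sum>ws\<in>?W l.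
      (-1) ^ (k * l) *\<^sub>R (b ws * a vs) *\<^sub>R deriv_word ws (deriv_word vs x))"
    by (intro sum.cong refl) (subst deriv_word_commute, simp add: mult_ac)
  also have "\<dots> = (-1) ^ (k * l) *\<^sub>R
      (\<Sum>ws\<in>?W l. \<Sum>vs\<in>?W k. (b ws * a vs) *\<^sub>R deriv_word ws (deriv_word vs x))"
    by (subst sum.swap) (simp add: scaleR_sum_right)
  also have "\<dots> = (-1) ^ (k * l) *\<^sub>R \<beta> (\<alpha> x)"
    by (simp add: a b linear_sum[OF linear_deriv_word] linear_scale[OF linear_deriv_word]
        scaleR_sum_right)
  finally show ?thesis .
qed

lemma Ext_odd_square_zero:
  assumes "\<alpha> \<in> Ext V k" "odd k"
  shows "\<alpha> (\<alpha> x) = 0"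
proof -
  \<comment> \<open>The exponent \<open>k * k\<close> is odd.\<close>
  have "\<alpha> (\<alpha> x) = - \<alpha> (\<alpha> x)"
    using Ext_commute[OF assms(1) assms(1), of x] assms(2) by simp
  then have "2 *\<^sub>R \<alpha> (\<alpha> x) = 0"
    by (metis add.right_inverse scaleR_2)
  then show ?thesis by simp
qed

section \<open>The action on simplicial chains\<close>

lemma subspace_simplicial_chains: "subspace (simplicial_chains K n)"
proof (rule subspaceI)
  fix x y :: "'a chain" and c :: real
  assume *: "x \<in> simplicial_chains K n" "y \<in> simplicial_chains K n"
  then show "x + y \<in> simplicial_chains K n"
    using Poly_Mapping.keys_add[of x y] by (auto simp: simplicial_chains_def)
  from * show "c *\<^sub>R x \<in> simplicial_chains K n"
    by (auto simp: simplicial_chains_def in_keys_iff)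
qed (simp add: simplicial_chains_def)

text \<open>Deleting a vertex keeps a list strictly increasing, so a non-empty face is a hyperedge
  contained in a simplex and lies in \<open>K\<close>; a single vertex is sent to zero.\<close>

lemma partial_deriv_simplicial_chains:
  assumes "simplicial_complex V K" "x \<in> simplicial_chains K n"
  shows "partial_deriv v x \<in> simplicial_chains K (n - 1)"
proof -
  have "path_deriv v p \<in> simplicial_chains K (n - 1)" if p: "p \<in> K" "int (length p) = n + 1" for p
  proof (cases "length p \<le> 1")
    case False
    have "Poly_Mapping.single (take i p @ drop (Suc i) p) 1 \<in> simplicial_chains K (n - 1)"
      if "i < length p" for i
    proof -
      let ?q = "take i p @ drop (Suc i) p"
      have p': "set p \<subseteq> V" "sorted_wrt (<) p"
        using assms(1) p unfolding simplicial_complex_def hyperedges_def by auto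
      \<comment> \<open>Exhibiting the deleted vertex between the two pieces lets sortedness of
        \<open>p\<close> pass to the pieces joined without it.\<close>
      have "sorted_wrt (<) (take i p @ p ! i # drop (Suc i) p)"
        using id_take_nth_drop[OF that] p'(2) by metis
      then have "sorted_wrt (<) ?q"
        by (simp add: sorted_wrt_append)
      moreover have "set ?q \<subseteq> set p"
        using set_take_subset[of i p] set_drop_subset[of "Suc i" p] by auto
      moreover have "length ?q = length p - 1" using that by simp
      moreover from this False have "?q \<noteq> []" by fastforce
      ultimately have "?q \<in> hyperedges V" using p' by (auto simp: hyperedges_def)
      then have "?q \<in> K"
        using \<open>set ?q \<subseteq> set p\<close> assms(1) p(1) unfolding simplicial_complex_def by blast
      then show ?thesis
        using \<open>length ?q = length p - 1\<close> False p(2) by (simp add: simplicial_chains_def)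
    qed
    then show ?thesis
      using False by (auto simp: path_deriv_def
          intro!: subspace_sum subspace_scale subspace_simplicial_chains)
  qed (simp add: path_deriv_def simplicial_chains_def)
  then show ?thesis
    using assms(2) unfolding partial_deriv_def linear_extend_def
    by (intro subspace_sum subspace_scale subspace_simplicial_chains)
      (auto simp: simplicial_chains_def)
qed

lemma deriv_word_simplicial_chains:
  assumes "simplicial_complex V K" "x \<in> simplicial_chains K n"
  shows "deriv_word vs x \<in> simplicial_chains K (n - int (length vs))"
proof (induction vs)
  case (Cons v vs)
  then show ?case
    using partial_deriv_simplicial_chains[OF assms(1) Cons, of v] by (simp add: algebra_simps)
qed (use assms in simp)

lemma Ext_simplicial_chains:
  assumes "simplicial_complex V K" "\<alpha> \<in> Ext V k" "x \<in> simplicial_chains K n"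
  shows "\<alpha> x \<in> simplicial_chains K (n - int k)"
  using assms(2) deriv_word_simplicial_chains[OF assms(1,3)] unfolding Ext_def
  by (auto intro!: subspace_sum subspace_scale subspace_simplicial_chains)

section \<open>Constrained homology as a quotient\<close>

text \<open>Quotient and remainder recombine to \<open>m\<close>, so the degree is affine in
  \<open>m\<close>. Replacing \<open>m\<close> by \<open>m - 2 * int s\<close> then simply lowers it
  by \<open>2 * s\<close>, even when the quotient changes.\<close>

lemma constrained_chains_eq:
  "constrained_chains K t m n = simplicial_chains K (int n * (2 * int t + 1) + m)"
  by (simp add: constrained_chains_def Let_def distrib_right add.assoc)

text \<open>The parameters \<open>m\<close> and \<open>n\<close> stay free, since groups for two
  values of \<open>m\<close> are compared and cycles in degree \<open>n\<close> involve chains in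
  degree \<open>n + 1\<close>.\<close>

locale constrained_complex =
  fixes V :: "'v::linorder set" and K :: "'v list set" and t :: nat
    and \<alpha> :: "'v chain \<Rightarrow> 'v chain"
  assumes complex: "simplicial_complex V K"
    and \<alpha>: "\<alpha> \<in> Ext V (2 * t + 1)"
begin

lemma linear_boundary: "linear (constrained_boundary \<alpha> n)"
  using linear_Ext[OF \<alpha>] module_hom_zero
  by (cases n) (auto simp: constrained_boundary_def[abs_def])

lemma subspace_cycles: "subspace (constrained_cycles K t \<alpha> m n)"
proof -
  have "subspace {x. constrained_boundary \<alpha> n x = 0}"
    by (rule linear_subspace_kernel[OF linear_boundary])
  from subspace_inter[OF subspace_simplicial_chains this] show ?thesis
    by (simp add: constrained_cycles_def constrained_chains_eq Int_def)
qed

lemma subspace_boundaries: "subspace (constrained_boundaries K t \<alpha> m n)"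
  unfolding constrained_boundaries_def constrained_chains_eq
  by (rule linear_subspace_image[OF linear_boundary subspace_simplicial_chains])

text \<open>This is where \<alpha> having odd degree enters: it squares to zero.\<close>

lemma boundaries_subset_cycles:
  "constrained_boundaries K t \<alpha> m n \<subseteq> constrained_cycles K t \<alpha> m n"
proof
  fix y assume "y \<in> constrained_boundaries K t \<alpha> m n"
  then obtain x where x: "x \<in> constrained_chains K t m (Suc n)" "y = \<alpha> x"
    by (auto simp: constrained_boundaries_def constrained_boundary_def)
  have "y \<in> constrained_chains K t m n"
    using Ext_simplicial_chains[OF complex \<alpha>] x by (force simp: constrained_chains_eq algebra_simps)
  then show "y \<in> constrained_cycles K t \<alpha> m n"
    using x Ext_odd_square_zero[OF \<alpha>]
    by (simp add: constrained_cycles_def constrained_boundary_def)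
qed

lemma comm_group_cycles: "comm_group (cycle_group K t \<alpha> m n)"
proof (rule comm_groupI)
  fix x assume "x \<in> carrier (cycle_group K t \<alpha> m n)"
  then show "\<exists>y\<in>carrier (cycle_group K t \<alpha> m n).
      y \<otimes>\<^bsub>cycle_group K t \<alpha> m n\<^esub> x = \<one>\<^bsub>cycle_group K t \<alpha> m n\<^esub>"
    by (intro bexI[of _ "- x"]) (simp_all add: cycle_group_def subspace_neg[OF subspace_cycles])
qed (auto simp: cycle_group_def subspace_0[OF subspace_cycles] subspace_add[OF subspace_cycles]
      add_ac)

lemma boundaries_normal: "constrained_boundaries K t \<alpha> m n \<lhd> cycle_group K t \<alpha> m n"
proof -
  interpret comm_group "cycle_group K t \<alpha> m n" by (rule comm_group_cycles)
  have inv: "inv\<^bsub>cycle_group K t \<alpha> m n\<^esub> x = - x" if "x \<in> constrained_cycles K t \<alpha> m n" for x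
    using that subspace_neg[OF subspace_cycles]
    by (intro inv_equality) (auto simp: cycle_group_def)
  have "subgroup (constrained_boundaries K t \<alpha> m n) (cycle_group K t \<alpha> m n)"
  proof (rule subgroupI)
    show "constrained_boundaries K t \<alpha> m n \<subseteq> carrier (cycle_group K t \<alpha> m n)"
      using boundaries_subset_cycles by (simp add: cycle_group_def)
    show "constrained_boundaries K t \<alpha> m n \<noteq> {}"
      using subspace_0[OF subspace_boundaries] by blast
    show "inv\<^bsub>cycle_group K t \<alpha> m n\<^esub> a \<in> constrained_boundaries K t \<alpha> m n"
      if "a \<in> constrained_boundaries K t \<alpha> m n" for a
      using that boundaries_subset_cycles
      by (subst inv) (auto intro: subspace_neg[OF subspace_boundaries])
  qed (simp add: cycle_group_def subspace_add[OF subspace_boundaries])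
  then show ?thesis by (rule subgroup_imp_normal)
qed

lemma group_homology: "group (constrained_homology K t \<alpha> m n)"
  unfolding constrained_homology_def by (rule normal.factorgroup_is_group[OF boundaries_normal])

lemma homology_class_eq_image:
  "homology_class K t \<alpha> m n x = (\<lambda>b. b + x) ` constrained_boundaries K t \<alpha> m n"
  by (auto simp: homology_class_def r_coset_def cycle_group_def)

lemma homology_class_eq_iff:
  "homology_class K t \<alpha> m n x = homology_class K t \<alpha> m n y
     \<longleftrightarrow> x - y \<in> constrained_boundaries K t \<alpha> m n"  (is "?C x = ?C y \<longleftrightarrow> x - y \<in> ?B")
proof
  assume "?C x = ?C y"
  moreover have "x \<in> ?C x"
    using subspace_0[OF subspace_boundaries] by (force simp: homology_class_eq_image)
  ultimately show "x - y \<in> ?B" by (auto simp: homology_class_eq_image)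
next
  assume *: "x - y \<in> ?B"
  \<comment> \<open>Each equation rewrites an element of one coset as an element of the other,
    giving both inclusions.\<close>
  have "b + x = (b + (x - y)) + y" "b + y = (b - (x - y)) + x" for b by simp_all
  then show "?C x = ?C y"
    using subspace_add[OF subspace_boundaries _ *] subspace_diff[OF subspace_boundaries _ *]
    unfolding homology_class_eq_image by (blast intro: sym image_eqI)
qed

text \<open>Scaled representatives of one class differ by boundaries, so the union defining
  \<open>homology_scale\<close> has equal members; it is not empty because the class is not.\<close>

lemma homology_scale_class:
  "homology_scale K t \<alpha> m n c (homology_class K t \<alpha> m n x) = homology_class K t \<alpha> m n (c *\<^sub>R x)"
proof -
  have "homology_class K t \<alpha> m n (c *\<^sub>R y) = homology_class K t \<alpha> m n (c *\<^sub>R x)"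
    if "y \<in> homology_class K t \<alpha> m n x" for y
    using that subspace_scale[OF subspace_boundaries]
    by (auto simp: homology_class_eq_iff homology_class_eq_image[of _ _ x] scaleR_add_right)
  moreover have "homology_class K t \<alpha> m n x \<noteq> {}"
    using subspace_0[OF subspace_boundaries] by (auto simp: homology_class_eq_image)
  ultimately show ?thesis unfolding homology_scale_def by auto
qed

lemma carrier_homology:
  "carrier (constrained_homology K t \<alpha> m n)
     = homology_class K t \<alpha> m n ` constrained_cycles K t \<alpha> m n"
  by (auto simp: constrained_homology_def FactGroup_def RCOSETS_def homology_class_def
      cycle_group_def)

lemma homology_class_hom:
  "homology_class K t \<alpha> m n \<in> hom (cycle_group K t \<alpha> m n) (constrained_homology K t \<alpha> m n)"
  using normal.r_coset_hom_Mod[OF boundaries_normal]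
  by (simp add: constrained_homology_def homology_class_def[abs_def])

end

section \<open>The induced map on constrained homology\<close>

theorem theorem4p6:
  fixes V :: "'v::linorder set" and K :: "'v list set"
    and t s :: nat and m l q :: int and n :: nat
    and \<alpha> \<beta> :: "'v chain \<Rightarrow> 'v chain"
  assumes "finite V"
    and "simplicial_complex V K"
    and "m = l * (2 * int t + 1) + q" and "0 \<le> q" and "q \<le> 2 * int t"
    and "\<alpha> \<in> Ext V (2 * t + 1)"
    and "\<beta> \<in> Ext V (2 * s)"
  shows "\<exists>h. group_hom (constrained_homology K t \<alpha> m n)
                (constrained_homology K t \<alpha> (m - 2 * int s) n) h
    \<and> (\<forall>c. \<forall>X\<in>carrier (constrained_homology K t \<alpha> m n).
          h (homology_scale K t \<alpha> m n c X)
            = homology_scale K t \<alpha> (m - 2 * int s) n c (h X))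
    \<and> (\<forall>x\<in>constrained_cycles K t \<alpha> m n.
          \<beta> x \<in> constrained_cycles K t \<alpha> (m - 2 * int s) n
          \<and> h (homology_class K t \<alpha> m n x)
              = homology_class K t \<alpha> (m - 2 * int s) n (\<beta> x))"
proof -
  interpret constrained_complex V K t \<alpha>
    using assms by unfold_locales
  let ?m' = "m - 2 * int s"
  let ?G = "cycle_group K t \<alpha> m n" and ?G' = "cycle_group K t \<alpha> ?m' n"
  let ?H' = "constrained_homology K t \<alpha> ?m' n"
  note lin = linear_Ext[OF assms(7)]
  \<comment> \<open>The sign exponent \<open>(2 * t + 1) * (2 * s)\<close> is even.\<close>
  have comm: "\<alpha> (\<beta> x) = \<beta> (\<alpha> x)" for x
    using Ext_commute[OF assms(6,7)] by simp
  \<comment> \<open>The degree \<open>n\<close> is generalised here because boundaries need the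
    statement at \<open>Suc n\<close>.\<close>
  have chain: "\<beta> x \<in> constrained_chains K t ?m' n" if "x \<in> constrained_chains K t m n" for x n
    using Ext_simplicial_chains[OF complex assms(7)] that
    by (force simp: constrained_chains_eq algebra_simps)
  have cycle: "\<beta> x \<in> constrained_cycles K t \<alpha> ?m' n" if "x \<in> constrained_cycles K t \<alpha> m n" for x
    using that chain linear_0[OF lin]
    by (auto simp: constrained_cycles_def constrained_boundary_def comm split: if_splits)
  have boundary: "\<beta> x \<in> constrained_boundaries K t \<alpha> ?m' n"
    if "x \<in> constrained_boundaries K t \<alpha> m n" for x
    using that chain by (auto simp: constrained_boundaries_def constrained_boundary_def comm[symmetric])
  have "\<beta> \<in> hom ?G ?G'"
    using cycle by (auto simp: hom_def cycle_group_def linear_add[OF lin])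
  then have f: "homology_class K t \<alpha> ?m' n \<circ> \<beta> \<in> hom ?G ?H'"
    using homology_class_hom by (rule hom_compose)
  \<comment> \<open>Containment in the kernel is what lets the map on cycles factor through the
    quotient by the boundaries.\<close>
  have "constrained_boundaries K t \<alpha> m n \<subseteq> kernel ?G ?H' (homology_class K t \<alpha> ?m' n \<circ> \<beta>)"
  proof
    fix x assume x: "x \<in> constrained_boundaries K t \<alpha> m n"
    have "homology_class K t \<alpha> ?m' n (\<beta> x) = homology_class K t \<alpha> ?m' n 0"
      using boundary[OF x] by (simp add: homology_class_eq_iff)
    also have "\<dots> = \<one>\<^bsub>?H'\<^esub>"
      by (simp add: homology_class_eq_image constrained_homology_def FactGroup_def)
    finally show "x \<in> kernel ?G ?H' (homology_class K t \<alpha> ?m' n \<circ> \<beta>)"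
      using x boundaries_subset_cycles by (auto simp: kernel_def cycle_group_def)
  qed
  moreover have "group_hom ?G ?H' (homology_class K t \<alpha> ?m' n \<circ> \<beta>)"
    using f comm_group_cycles group_homology
    by (simp add: group_hom_def group_hom_axioms_def comm_group.axioms(2))
  ultimately obtain h where h: "h \<in> hom (constrained_homology K t \<alpha> m n) ?H'"
    and "\<And>x. x \<in> carrier ?G \<Longrightarrow> h (constrained_boundaries K t \<alpha> m n #>\<^bsub>?G\<^esub> x)
      = (homology_class K t \<alpha> ?m' n \<circ> \<beta>) x"
    using group_hom.FactGroup_universal_kernel[OF _ boundaries_normal]
    unfolding constrained_homology_def by metis
  then have h_class: "h (homology_class K t \<alpha> m n x) = homology_class K t \<alpha> ?m' n (\<beta> x)"
    if "x \<in> constrained_cycles K t \<alpha> m n" for x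
    using that by (simp add: homology_class_def cycle_group_def)
  have "group_hom (constrained_homology K t \<alpha> m n) ?H' h"
    using h group_homology by (simp add: group_hom_def group_hom_axioms_def)
  \<comment> \<open>The quotient's universal property yields only additivity; compatibility with
    scalars is checked on a representative cycle, using linearity of \<beta>.\<close>
  moreover have "h (homology_scale K t \<alpha> m n c X) = homology_scale K t \<alpha> ?m' n c (h X)"
    if "X \<in> carrier (constrained_homology K t \<alpha> m n)" for c X
    using that by (auto simp: carrier_homology homology_scale_class h_class linear_scale[OF lin]
        subspace_scale[OF subspace_cycles])
  ultimately show ?thesis
    using cycle h_class by blast
qed

end
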